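(* Let $X\in\mathbb{R}^{n\times m}$ with $n>m$ and let $k\ge1$ be an integer with $2k\le m$. Consider the minors $\det(X_{\alpha,\beta})$ for all $$\alpha=\{1,\dots,k-r\}\cup\{t,\dots,t+r-1\},\quad r\in\{1,\dots,k\},\ t\in\{k-r+1,\dots,n-r+1\},$$ and all $$\beta=\{1,\dots,k-\bar r\}\cup\{\bar t,\dots,\bar t+\bar r-1\},\quad \bar r\in\{1,\dots,k\},\ \bar t\in\{k-\bar r+1,\dots,m-\bar r+1\}.$$ Suppose that these minors all have the same strict sign (all positive or all negative), except for the cases where simultaneously $\alpha=\{t,\dots,t+k-1\}$ (i.e. $r=k$) with $t\in\{k+1,\dots,n-k+1\}$ and $\beta=\{\bar t,\dots,\bar t+k-1\}$ (i.e. $\bar r=k$) with $\bar t\in\{k+1,\dots,m-k+1\}$, for which it is only required that the minor has that same sign in the non-strict sense ($\ge0$, respectively $\le0$). Then $X$ is $k$-sign consistent.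
   Context: $X_{\alpha,\beta}$ denotes the submatrix of $X$ with row indices $\alpha$ and column indices $\beta$. A set $\{i,\dots,j\}$ with $i>j$ is empty. A matrix $X\in\mathbb{R}^{n\times m}$ is $k$-sign consistent if all its $k\times k$ minors are nonnegative, or all its $k\times k$ minors are nonpositive. *)

theory Defs
  imports "Jordan_Normal_Form.Determinant" "Jordan_Normal_Form.DL_Submatrix"
begin

(* Matrix indices start at 0, so every 1-based index set {a, ..., b} is shifted to
   {a - 1, ..., b - 1}.  A k x k minor of X is det (submatrix X \<alpha> \<beta>) for sets of k row
   and k column indices. *)

definition sign_consistent :: "nat \<Rightarrow> real mat \<Rightarrow> bool" where
  "sign_consistent k X \<longleftrightarrow>
     (\<forall>\<alpha> \<beta>. \<alpha> \<subseteq> {..<dim_row X} \<and> card \<alpha> = k \<and> \<beta> \<subseteq> {..<dim_col X} \<and> card \<beta> = k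
        \<longrightarrow> det (submatrix X \<alpha> \<beta>) \<ge> 0) \<or>
     (\<forall>\<alpha> \<beta>. \<alpha> \<subseteq> {..<dim_row X} \<and> card \<alpha> = k \<and> \<beta> \<subseteq> {..<dim_col X} \<and> card \<beta> = k
        \<longrightarrow> det (submatrix X \<alpha> \<beta>) \<le> 0)"

(* With 1-based indices: {1, ..., k - r} \<union> {t, ..., t + r - 1}
   for 1 \<le> r \<le> k and k - r + 1 \<le> t \<le> N - r + 1. *)
definition test_index_sets :: "nat \<Rightarrow> nat \<Rightarrow> nat set set" where
  "test_index_sets k N =
     {{..<k - r} \<union> {t..<t + r} | r t. r \<in> {1..k} \<and> t \<in> {k - r..N - r}}"

(* With 1-based indices: {t, ..., t + k - 1} for k + 1 \<le> t \<le> N - k + 1. *)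
definition weak_index_sets :: "nat \<Rightarrow> nat \<Rightarrow> nat set set" where
  "weak_index_sets k N = {{t..<t + k} | t. t \<in> {k..N - k}}"

end

theory Submission
  imports Defs
begin

text \<open>
  Fix the columns of \<open>X\<close>. The maximal minors of the remaining \<open>k\<close>-column matrix, as a function \<open>p\<close>
  of the row set, satisfy the three-term Pluecker relations
  \<open>p(Sac) p(Sbd) = p(Sab) p(Scd) + p(Sad) p(Sbc)\<close> for \<open>a < b < c < d\<close>
  (\<open>three_term_plucker_row_det\<close>). These relations have no minus sign, so positivity spreads
  through them, and they are all that the argument knows about determinants.

  Call \<open>{..<e}\<close> the prefix of a \<open>k\<close>-set \<open>{..<e} \<union> \<gamma>\<close>. Sets with a long prefix come first, and within
  a given prefix length the spread of \<open>\<gamma>\<close> is reduced as in Fekete's criterion for total positivity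
  (\<open>positive_of_intervals\<close>): if \<open>\<gamma>\<close> omits some \<open>j\<close> between its least element \<open>l\<close> and its greatest
  element \<open>u\<close>, and also omits \<open>e\<close>, take the Pluecker relation for \<open>e < l < j < u\<close>. The factors that
  contain \<open>e\<close> have a longer prefix and are already positive; the other two factors on the right
  replace \<open>u\<close> or \<open>l\<close> by \<open>j\<close> and are less spread out. What cannot be reduced is a prefix
  together with an interval, which is a test set.

  The weakly constrained sets are intervals disjoint from \<open>{..<k}\<close>. They enter only at the last stage
  \<open>e = 0\<close>, where every factor they are multiplied with contains \<open>0\<close> and is strictly
  positive, so nonnegativity still propagates (\<open>positive_of_test_sets\<close>).

  The criterion is applied twice (\<open>signed_minors_nonneg\<close>): to the rows for every column test set, and
  then to the columns for an arbitrary row set. In the first application a column set that is not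
  weak has strictly positive minors against all test row sets, hence against all row sets, which is
  the strictness required by the second application. The relations are quadratic and homogeneous,
  so a common sign of all minors can be absorbed into \<open>p\<close>.
\<close>

section \<open>Determinants of selected rows\<close>

text \<open>
  Lists keep the order of the selected rows, so that signs of reorderings can be tracked; the
  sorted list of a set gives the minor of that set. Rows are functions, which lets the same
  notion describe row and column selections.
\<close>

definition row_det :: "nat \<Rightarrow> (nat \<Rightarrow> nat \<Rightarrow> 'a :: field) \<Rightarrow> nat list \<Rightarrow> 'a" where
  "row_det k f is = det (mat k k (\<lambda>(i, j). f (is ! i) j))"

lemma row_det_swap_adjacent:
  assumes "length xs + length ys + 2 = k"
  shows "row_det k f (xs @ a # b # ys) = - row_det k f (xs @ b # a # ys)"
proof -
  let ?l = "length xs"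
  let ?A = "mat k k (\<lambda>(i, j). f ((xs @ b # a # ys) ! i) j)"
  have "mat k k (\<lambda>(i, j). f ((xs @ a # b # ys) ! i) j) = swaprows ?l (Suc ?l) ?A"
    using assms by (intro eq_matI) (auto simp: nth_append nth_Cons split: nat.splits)
  then show ?thesis
    unfolding row_det_def using assms det_swaprows[of ?l k "Suc ?l" ?A] by simp
qed

lemma row_det_repeated:
  assumes "length is = k" "\<not> distinct is"
  shows "row_det k f is = 0"
proof -
  from assms obtain i j where "i < k" "j < k" "i \<noteq> j" "is ! i = is ! j"
    by (auto simp: distinct_conv_nth)
  then show ?thesis
    unfolding row_det_def by (intro det_identical_rows[of _ k i j]) auto
qed

text \<open>
  Insertion moves \<open>u\<close> to the left past exactly the elements that exceed it, one adjacent swap each.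
  The untouched list \<open>zs\<close> in front is what makes the induction go through.
\<close>

lemma row_det_insort:
  assumes "sorted xs" "length zs + length xs + length ys + 1 = k"
  shows "row_det k f (zs @ xs @ u # ys) =
    (- 1) ^ length (filter (\<lambda>x. u < x) xs) * row_det k f (zs @ insort u xs @ ys)"
  using assms
proof (induction xs arbitrary: zs)
  case Nil
  then show ?case by simp
next
  case (Cons x xs)
  have IH: "row_det k f (zs @ x # xs @ u # ys) =
      (- 1) ^ length (filter (\<lambda>x. u < x) xs) * row_det k f (zs @ x # insort u xs @ ys)"
    using Cons.IH[of "zs @ [x]"] Cons.prems by simp
  show ?case
  proof (cases "u < x")
    case True
    then have "insort u xs = u # xs"
      using Cons.prems(1) by (cases xs) auto
    then show ?thesis
      using IH True row_det_swap_adjacent[of zs "xs @ ys" k f x u] Cons.prems(2) by simp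
  next
    case False
    show ?thesis
    proof (cases "u = x")
      case True
      then have "insort u xs = u # xs"
        using Cons.prems(1) by (cases xs) auto
      then show ?thesis using IH True by simp
    qed (use IH False in simp)
  qed
qed

text \<open>
  Laplace expansion along the row of \<open>v\<close>: the cofactors are formed from the other rows only.
\<close>

lemma row_det_linear:
  assumes "length S + 2 = k"
  shows "\<exists>C. \<forall>v. row_det k f (S @ [v, d]) = (\<Sum>j<k. f v j * C j)"
proof (intro exI allI)
  fix v
  let ?M = "\<lambda>v. mat k k (\<lambda>(i, j). f ((S @ [v, d]) ! i) j)"
  have "mat_delete (?M v) (length S) j = mat_delete (?M d) (length S) j" for j
    unfolding mat_delete_def using assms by (intro eq_matI) (auto simp: nth_append nth_Cons')
  moreover have "det (?M v) = (\<Sum>j<k. ?M v $$ (length S, j) * cofactor (?M v) (length S) j)"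
    by (rule laplace_expansion_row) (use assms in auto)
  ultimately show "row_det k f (S @ [v, d]) =
      (\<Sum>j<k. f v j * cofactor (?M d) (length S) j)"
    unfolding row_det_def using assms by (simp add: cofactor_def)
qed

text \<open>
  Extend the \<open>k + 1\<close> rows \<open>S, a, b, c\<close> by a last column with entries \<open>h v = det (S, v, d)\<close>. Since \<open>h\<close>
  is a linear functional of the row, the new column depends on the others and the determinant
  vanishes. Expanding it along the new column leaves only the rows \<open>a\<close>, \<open>b\<close>, \<open>c\<close>, because \<open>h\<close> is zero
  on the rows of \<open>S\<close>.
\<close>

lemma row_det_plucker:
  assumes "length S + 2 = k"
  shows "row_det k f (S @ [a, c]) * row_det k f (S @ [b, d]) =
    row_det k f (S @ [a, b]) * row_det k f (S @ [c, d]) +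
    row_det k f (S @ [a, d]) * row_det k f (S @ [b, c])"
proof -
  let ?q = "length S"
  define h where "h v = row_det k f (S @ [v, d])" for v
  obtain C where C: "\<And>v. h v = (\<Sum>j<k. f v j * C j)"
    using row_det_linear[OF assms, of f d] unfolding h_def by blast
  define xs where "xs = S @ [a, b, c]"
  have len: "length xs = Suc k" using assms by (simp add: xs_def)
  define G where
    "G = mat (Suc k) (Suc k) (\<lambda>(i, j). if j < k then f (xs ! i) j else h (xs ! i))"
  have G: "G \<in> carrier_mat (Suc k) (Suc k)" by (simp add: G_def)
  have "det G = 0"
  proof -
    \<comment> \<open>the linear dependence of the columns: \<open>h v\<close> is the combination of the entries of \<open>v\<close> with weights \<open>C\<close>\<close>
    define w where "w = vec (Suc k) (\<lambda>j. if j < k then C j else - 1)"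
    have "w \<noteq> 0\<^sub>v (Suc k)"
    proof
      assume "w = 0\<^sub>v (Suc k)"
      then have "w $ k = 0\<^sub>v (Suc k) $ k" by simp
      then show False by (simp add: w_def)
    qed
    moreover have "G *\<^sub>v w = 0\<^sub>v (Suc k)"
    proof (rule eq_vecI)
      fix i assume "i < dim_vec (0\<^sub>v (Suc k) :: 'a vec)"
      then have i: "i < Suc k" by simp
      have "(G *\<^sub>v w) $ i = (\<Sum>j<Suc k. G $$ (i, j) * w $ j)"
        using i G by (simp add: scalar_prod_def w_def atLeast0LessThan)
      also have "\<dots> = 0"
        using i by (simp add: G_def w_def C)
      finally show "(G *\<^sub>v w) $ i = 0\<^sub>v (Suc k) $ i" using i by simp
    qed (simp add: G_def)
    ultimately show ?thesis
      unfolding det_0_iff_vec_prod_zero_field[OF G] by (auto simp: w_def intro!: exI[of _ w])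
  qed
  moreover have "det G = (\<Sum>i<Suc k. G $$ (i, k) * cofactor G i k)"
    by (rule laplace_expansion_column[OF G]) simp
  moreover have "Suc k = Suc (Suc (Suc ?q))" using assms by simp
  moreover have "G $$ (i, k) = 0" if "i < ?q" for i
    using that assms row_det_repeated[of "S @ [S ! i, d]" k f]
    by (simp add: G_def xs_def h_def nth_append)
  moreover have "mat_delete G ?q k = mat k k (\<lambda>(i, j). f ((S @ [b, c]) ! i) j)"
    "mat_delete G (Suc ?q) k = mat k k (\<lambda>(i, j). f ((S @ [a, c]) ! i) j)"
    "mat_delete G (Suc (Suc ?q)) k = mat k k (\<lambda>(i, j). f ((S @ [a, b]) ! i) j)"
    unfolding mat_delete_def G_def xs_def using assms
    by (intro eq_matI; auto simp: nth_append nth_Cons')+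
  moreover have "G $$ (?q, k) = h a" "G $$ (Suc ?q, k) = h b" "G $$ (Suc (Suc ?q), k) = h c"
    using assms by (auto simp: G_def xs_def nth_append)
  ultimately have "0 = h a * row_det k f (S @ [b, c]) - h b * row_det k f (S @ [a, c])
      + h c * row_det k f (S @ [a, b])"
    using assms by (auto simp: cofactor_def row_det_def)
  then show ?thesis
    by (simp add: h_def algebra_simps)
qed

section \<open>Three-term Pluecker relations for minors\<close>

definition three_term_plucker :: "nat \<Rightarrow> nat \<Rightarrow> (nat set \<Rightarrow> 'a :: comm_ring_1) \<Rightarrow> bool" where
  "three_term_plucker k N p \<longleftrightarrow>
     (\<forall>S a b c d. a < b \<and> b < c \<and> c < d \<and> d < N \<and> S \<subseteq> {..<N} - {a, b, c, d} \<and> card S + 2 = k \<longrightarrow>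
        p (S \<union> {a, c}) * p (S \<union> {b, d}) =
        p (S \<union> {a, b}) * p (S \<union> {c, d}) + p (S \<union> {a, d}) * p (S \<union> {b, c}))"

lemma three_term_plucker_scale:
  assumes "three_term_plucker k N p"
  shows "three_term_plucker k N (\<lambda>\<alpha>. c * p \<alpha>)"
  unfolding three_term_plucker_def
proof (intro allI impI)
  fix S a b u d
  assume "a < b \<and> b < u \<and> u < d \<and> d < N \<and> S \<subseteq> {..<N} - {a, b, u, d} \<and> card S + 2 = k"
  then have "p (S \<union> {a, u}) * p (S \<union> {b, d}) =
      p (S \<union> {a, b}) * p (S \<union> {u, d}) + p (S \<union> {a, d}) * p (S \<union> {b, u})"
    using assms unfolding three_term_plucker_def by blast
  then have "c * c * (p (S \<union> {a, u}) * p (S \<union> {b, d})) =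
      c * c * (p (S \<union> {a, b}) * p (S \<union> {u, d}) + p (S \<union> {a, d}) * p (S \<union> {b, u}))"
    by simp
  then show "c * p (S \<union> {a, u}) * (c * p (S \<union> {b, d})) =
      c * p (S \<union> {a, b}) * (c * p (S \<union> {u, d})) + c * p (S \<union> {a, d}) * (c * p (S \<union> {b, u}))"
    by (simp add: algebra_simps)
qed

text \<open>
  The sign is a product of one factor per element because \<open>u < v\<close>: when \<open>v\<close> is inserted after \<open>u\<close>,
  it does not pass \<open>u\<close>.
\<close>

lemma row_det_sort_last_two:
  assumes "finite S" "card S + 2 = k" "u \<notin> S" "v \<notin> S" "u < v"
  defines "\<sigma> \<equiv> \<lambda>w. (- 1) ^ card {x \<in> S. w < x}"
  shows "row_det k f (sorted_list_of_set S @ [u, v]) =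
    \<sigma> u * \<sigma> v * row_det k f (sorted_list_of_set (S \<union> {u, v}))"
proof -
  let ?s = sorted_list_of_set
  have count: "length (filter (\<lambda>x. w < x) (?s T)) = card {x \<in> T. w < x}" if "finite T" for w T
    using that distinct_card[of "filter (\<lambda>x. w < x) (?s T)"] by simp
  have "row_det k f (?s S @ [u, v]) = \<sigma> u * row_det k f (?s (insert u S) @ [v])"
    using row_det_insort[of "?s S" "[]" "[v]" k f u] assms(1-4) by (simp add: count \<sigma>_def)
  also have "row_det k f (?s (insert u S) @ [v]) =
      (- 1) ^ card {x \<in> insert u S. v < x} * row_det k f (?s (insert v (insert u S)))"
  proof -
    have "?s (insert v (insert u S)) = insort v (?s (insert u S))"
      using assms by (intro sorted_list_of_set_insert) auto
    moreover have "length (filter (\<lambda>x. v < x) (?s (insert u S))) = card {x \<in> insert u S. v < x}"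
      using assms(1) by (intro count) simp
    moreover have "sorted (?s (insert u S))" "length (?s (insert u S)) + 1 = k"
      using assms(1-3) by (simp_all only: sorted_sorted_list_of_set length_sorted_list_of_set) simp
    ultimately show ?thesis
      using row_det_insort[of "?s (insert u S)" "[]" "[]" k f v] by (simp only: append_Nil append_Nil2 list.size add_0 add_0_right)
  qed
  also have "{x \<in> insert u S. v < x} = {x \<in> S. v < x}" using assms(5) by auto
  finally show ?thesis by (simp add: \<sigma>_def insert_commute)
qed

text \<open>
  Sorting turns the relation for lists into one for sets without any sign: each of the three
  products acquires the same factor, one sign for each of \<open>a\<close>, \<open>b\<close>, \<open>c\<close>, \<open>d\<close>.
\<close>

lemma three_term_plucker_row_det:
  "three_term_plucker k N (\<lambda>\<alpha>. row_det k f (sorted_list_of_set \<alpha>))"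
  unfolding three_term_plucker_def
proof (intro allI impI, elim conjE)
  fix S a b c d
  assume ord: "a < b" "b < c" "c < d" "d < N" and S: "S \<subseteq> {..<N} - {a, b, c, d}" "card S + 2 = k"
  let ?p = "\<lambda>\<alpha>. row_det k f (sorted_list_of_set \<alpha>)"
  have fin: "finite S" using S(1) finite_subset by blast
  define \<sigma> :: "nat \<Rightarrow> 'a" where "\<sigma> w = (- 1) ^ card {x \<in> S. w < x}" for w
  have sort: "row_det k f (sorted_list_of_set S @ [u, v]) = \<sigma> u * \<sigma> v * ?p (S \<union> {u, v})"
    if "u < v" "u \<in> {a, b, c, d}" "v \<in> {a, b, c, d}" for u v
    unfolding \<sigma>_def using that S fin by (intro row_det_sort_last_two) auto
  have "\<sigma> a * \<sigma> b * \<sigma> c * \<sigma> d * (?p (S \<union> {a, c}) * ?p (S \<union> {b, d})) =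
      \<sigma> a * \<sigma> b * \<sigma> c * \<sigma> d *
        (?p (S \<union> {a, b}) * ?p (S \<union> {c, d}) + ?p (S \<union> {a, d}) * ?p (S \<union> {b, c}))"
    using row_det_plucker[of "sorted_list_of_set S" k f a c b d] S(2) ord
    by (simp add: sort algebra_simps)
  moreover have "\<sigma> a * \<sigma> b * \<sigma> c * \<sigma> d \<noteq> 0"
    by (simp add: \<sigma>_def)
  ultimately show "?p (S \<union> {a, c}) * ?p (S \<union> {b, d}) =
      ?p (S \<union> {a, b}) * ?p (S \<union> {c, d}) + ?p (S \<union> {a, d}) * ?p (S \<union> {b, c})"
    by simp
qed

lemma pick_eq_sorted_list_of_set_nth:
  assumes "finite I" "i < card I"
  shows "pick I i = sorted_list_of_set I ! i"
proof -
  let ?xs = "map (pick I) [0..<card I]"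
  have "sorted_wrt (<) ?xs"
    by (auto simp: sorted_wrt_iff_nth_less intro: pick_mono_le)
  moreover from this have "distinct ?xs" by (simp add: strict_sorted_iff)
  then have "card (set ?xs) = card I" by (simp only: distinct_card) simp
  moreover have "set ?xs \<subseteq> I" by (auto simp: pick_in_set_le)
  ultimately have "?xs = sorted_list_of_set I"
    using assms(1) sorted_list_of_set_unique[of I ?xs] card_subset_eq[of I "set ?xs"] by simp
  then show ?thesis using assms(2) by (metis nth_map_upt add_0 diff_zero)
qed

lemma det_submatrix_eq_row_det:
  assumes "\<alpha> \<subseteq> {..<dim_row X}" "card \<alpha> = k" "\<beta> \<subseteq> {..<dim_col X}" "card \<beta> = k"
  shows "det (submatrix X \<alpha> \<beta>) =
    row_det k (\<lambda>i j. X $$ (i, sorted_list_of_set \<beta> ! j)) (sorted_list_of_set \<alpha>)"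
proof -
  have "{i. i < dim_row X \<and> i \<in> \<alpha>} = \<alpha>" "{i. i < dim_col X \<and> i \<in> \<beta>} = \<beta>"
    using assms by auto
  moreover have "finite \<alpha>" "finite \<beta>" using assms finite_subset by blast+
  ultimately show ?thesis
    unfolding row_det_def submatrix_def using assms
    by (intro arg_cong[of _ _ det] eq_matI) (auto simp: pick_eq_sorted_list_of_set_nth)
qed

lemma det_submatrix_eq_col_det:
  assumes "\<alpha> \<subseteq> {..<dim_row X}" "card \<alpha> = k" "\<beta> \<subseteq> {..<dim_col X}" "card \<beta> = k"
  shows "det (submatrix X \<alpha> \<beta>) =
    row_det k (\<lambda>j i. X $$ (sorted_list_of_set \<alpha> ! i, j)) (sorted_list_of_set \<beta>)"
proof -
  let ?A = "mat k k (\<lambda>(i, j). X $$ (sorted_list_of_set \<alpha> ! i, sorted_list_of_set \<beta> ! j))"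
  have "det ?A = det ?A\<^sup>T" by (rule det_transpose[symmetric]) auto
  also have "?A\<^sup>T = mat k k (\<lambda>(j, i). X $$ (sorted_list_of_set \<alpha> ! i, sorted_list_of_set \<beta> ! j))"
    by (intro eq_matI) auto
  finally show ?thesis
    using det_submatrix_eq_row_det[OF assms] by (simp add: row_det_def)
qed

section \<open>Positivity from test sets\<close>

text \<open>
  Induction on the width of a window \<open>{l..<l + w}\<close> that contains \<open>\<gamma>\<close>. The flag \<open>strict\<close> treats positive
  and nonnegative values on intervals at once: in the Pluecker relation these values are only
  ever multiplied by values from \<open>front\<close>, which are strictly positive.
\<close>

lemma positive_of_intervals:
  fixes p :: "nat set \<Rightarrow> real"
  assumes "three_term_plucker k N p" "e + r = k"
    and front: "\<And>\<gamma>. \<gamma> \<subseteq> {Suc e..<N} \<Longrightarrow> Suc (card \<gamma>) = r \<Longrightarrow> 0 < p ({..e} \<union> \<gamma>)"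
    and interval: "\<And>t. e \<le> t \<Longrightarrow> t + r \<le> N \<Longrightarrow>
      0 \<le> p ({..<e} \<union> {t..<t + r}) \<and> (strict \<longrightarrow> 0 < p ({..<e} \<union> {t..<t + r}))"
    and "\<gamma> \<subseteq> {l..<l + w}" "card \<gamma> = r" "e \<le> l" "l + w \<le> N"
  shows "0 \<le> p ({..<e} \<union> \<gamma>) \<and> (strict \<longrightarrow> 0 < p ({..<e} \<union> \<gamma>))"
  using assms(5-8)
proof (induction w arbitrary: \<gamma> l)
  case 0
  then show ?case using interval[of l] by auto
next
  case (Suc w)
  let ?P = "\<lambda>x. 0 \<le> x \<and> (strict \<longrightarrow> 0 < x)"
  have fin: "finite \<gamma>" using Suc.prems(1) finite_subset by blast
  have ends: "{l..<l + Suc w} = {l, l + w} \<union> {l<..<l + w}" by auto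
  have gap: "\<gamma> = {l..<l + Suc w} \<or> l \<notin> \<gamma> \<or> l + w \<notin> \<gamma> \<or> (\<exists>j. j \<notin> \<gamma> \<and> l < j \<and> j < l + w)"
  proof (rule ccontr)
    assume "\<not> ?thesis"
    then have "{l..<l + Suc w} \<subseteq> \<gamma>" "\<gamma> \<noteq> {l..<l + Suc w}" unfolding ends by auto
    with Suc.prems(1) show False by simp
  qed
  consider "l \<notin> \<gamma>" | "l + w \<notin> \<gamma>" | "e \<in> \<gamma>" | "\<gamma> = {l..<l + Suc w}"
    | j where "l \<in> \<gamma>" "l + w \<in> \<gamma>" "e \<notin> \<gamma>" "j \<notin> \<gamma>" "l < j" "j < l + w"
    using gap by metis
  then show ?case
  proof cases
    case 1
    moreover have "{l..<l + Suc w} = insert l {Suc l..<Suc l + w}" by auto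
    ultimately have "\<gamma> \<subseteq> {Suc l..<Suc l + w}" using Suc.prems(1) by (metis subset_insert)
    then show ?thesis using Suc.IH[of \<gamma> "Suc l"] Suc.prems by simp
  next
    case 2
    moreover have "{l..<l + Suc w} = insert (l + w) {l..<l + w}" by auto
    ultimately have "\<gamma> \<subseteq> {l..<l + w}" using Suc.prems(1) by (metis subset_insert)
    then show ?thesis using Suc.IH[of \<gamma> l] Suc.prems by simp
  next
    case 3
    have "Suc (card (\<gamma> - {e})) = r" using card_Suc_Diff1[OF fin 3] Suc.prems(2) by simp
    moreover have "\<gamma> - {e} \<subseteq> {Suc e..<N}"
    proof
      fix x assume "x \<in> \<gamma> - {e}"
      then have "x \<in> {l..<l + Suc w}" "x \<noteq> e" using Suc.prems(1) by auto
      then show "x \<in> {Suc e..<N}" using Suc.prems(3,4) by auto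
    qed
    moreover have "{..e} \<union> (\<gamma> - {e}) = {..<e} \<union> \<gamma>"
      using 3 by (auto simp: order.order_iff_strict)
    ultimately show ?thesis using front[of "\<gamma> - {e}"] by simp
  next
    case 4
    then have "r = Suc w" using Suc.prems(2) by simp
    then show ?thesis using interval[of l] Suc.prems 4 by simp
  next
    case (5 j)
    define T where "T = \<gamma> - {l, l + w}"
    define S where "S = {..<e} \<union> T"
    have "e < l" using 5 Suc.prems(3) by (metis le_neq_implies_less)
    have T: "T \<subseteq> {l<..<l + w}" "finite T" "j \<notin> T"
      using Suc.prems(1) fin 5 unfolding T_def ends by (simp_all add: Diff_subset_conv)
    have notin: "l \<notin> T" "l + w \<notin> T" unfolding T_def by auto
    have \<gamma>: "\<gamma> = T \<union> {l, l + w}" using 5 unfolding T_def by auto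
    have cardT: "card T + 2 = r"
      using Suc.prems(2) 5 T notin by (simp add: \<gamma>)
    have "card S = e + card T"
      unfolding S_def using T \<open>e < l\<close> by (subst card_Un_disjoint) auto
    then have cardS: "card S + 2 = k" using cardT assms(2) by simp
    have "S \<subseteq> {..<N} - {e, l, j, l + w}"
      using T Suc.prems(4) \<open>e < l\<close> 5 unfolding S_def by auto
    \<comment> \<open>the unknown factor is the second one on the left, \<open>S \<union> {l, l + w} = {..<e} \<union> \<gamma>\<close>\<close>
    then have plucker: "p (S \<union> {e, j}) * p (S \<union> {l, l + w}) =
        p (S \<union> {e, l}) * p (S \<union> {j, l + w}) + p (S \<union> {e, l + w}) * p (S \<union> {l, j})"
      using assms(1) cardS 5 \<open>e < l\<close> Suc.prems(4) unfolding three_term_plucker_def by auto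
    have front': "0 < p (S \<union> {e, x})" if "x \<notin> T" "l \<le> x" "x \<le> l + w" for x
    proof -
      have "S \<union> {e, x} = {..e} \<union> insert x T" unfolding S_def by (auto simp: order.order_iff_strict)
      moreover have "insert x T \<subseteq> {Suc e..<N}"
        using T(1) that \<open>e < l\<close> Suc.prems(4) by (auto simp: subset_iff)
      ultimately show ?thesis using front[of "insert x T"] cardT T that by simp
    qed
    have "?P (p (S \<union> {j, l + w}))"
      unfolding S_def Un_assoc
      by (rule Suc.IH[of _ "Suc l"])
        (use T 5 cardT notin Suc.prems in \<open>auto simp: subset_iff\<close>)
    moreover have "?P (p (S \<union> {l, j}))"
      unfolding S_def Un_assoc
      by (rule Suc.IH[of _ l])
        (use T 5 cardT notin Suc.prems in \<open>auto simp: subset_iff\<close>)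
    moreover have "0 < p (S \<union> {e, l})" "0 < p (S \<union> {e, l + w})" "0 < p (S \<union> {e, j})"
      using front' 5 T notin by auto
    moreover have "?P (x * y + z * u)" if "0 < x" "?P y" "0 < z" "?P u" for x y z u :: real
      using that by (simp add: add_pos_pos)
    ultimately have "?P (p (S \<union> {e, j}) * p (S \<union> {l, l + w}))"
      unfolding plucker by blast
    then have "?P (p (S \<union> {l, l + w}))"
      using \<open>0 < p (S \<union> {e, j})\<close> by (simp add: zero_le_mult_iff zero_less_mult_iff)
    then show ?thesis
      unfolding \<gamma> S_def Un_assoc .
  qed
qed

lemma test_index_set_subset_card:
  assumes "k \<le> N" "\<alpha> \<in> test_index_sets k N"
  shows "\<alpha> \<subseteq> {..<N}" "card \<alpha> = k"
proof -
  obtain r t where \<alpha>: "\<alpha> = {..<k - r} \<union> {t..<t + r}" "r \<in> {1..k}" "t \<in> {k - r..N - r}"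
    using assms(2) unfolding test_index_sets_def by auto
  then show "\<alpha> \<subseteq> {..<N}" using assms(1) by auto
  show "card \<alpha> = k" unfolding \<alpha>(1) using \<alpha>(2,3) by (subst card_Un_disjoint) auto
qed

lemma weak_index_sets_subset:
  assumes "k \<ge> 1"
  shows "weak_index_sets k N \<subseteq> test_index_sets k N"
proof
  fix \<alpha> assume "\<alpha> \<in> weak_index_sets k N"
  then obtain t where "\<alpha> = {t..<t + k}" "t \<in> {k..N - k}" unfolding weak_index_sets_def by auto
  then show "\<alpha> \<in> test_index_sets k N"
    unfolding test_index_sets_def using assms
    by (intro CollectI exI[of _ k] exI[of _ t]) auto
qed

lemma zero_notin_weak_index_set:
  assumes "k \<ge> 1" "\<alpha> \<in> weak_index_sets k N"
  shows "0 \<notin> \<alpha>"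
  using assms unfolding weak_index_sets_def by auto

text \<open>
  The hypothesis \<open>r < k\<close> keeps \<open>0\<close> in every set that occurs in the induction on \<open>r\<close>, and weak sets do
  not contain \<open>0\<close>.
\<close>

lemma prefix_positive:
  fixes p :: "nat set \<Rightarrow> real"
  assumes "three_term_plucker k N p" "k \<ge> 1" "k \<le> N"
    and test: "\<And>\<alpha>. \<alpha> \<in> test_index_sets k N \<Longrightarrow> \<alpha> \<notin> weak_index_sets k N \<Longrightarrow> 0 < p \<alpha>"
    and "r < k" "\<gamma> \<subseteq> {k - r..<N}" "card \<gamma> = r"
  shows "0 < p ({..<k - r} \<union> \<gamma>)"
  using assms(5-7)
proof (induction r arbitrary: \<gamma>)
  case 0
  have "{..<k} \<in> test_index_sets k N"
    unfolding test_index_sets_def using assms(2,3) by (force intro: exI[of _ k] exI[of _ 0])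
  moreover have "0 \<in> {..<k}" using assms(2) by simp
  then have "{..<k} \<notin> weak_index_sets k N" using zero_notin_weak_index_set[OF assms(2)] by blast
  moreover have "\<gamma> = {}" using 0 by (metis card_0_eq finite_subset finite_atLeastLessThan)
  ultimately show ?case using test by simp
next
  case (Suc r)
  have "0 \<le> p ({..<k - Suc r} \<union> \<gamma>) \<and> (True \<longrightarrow> 0 < p ({..<k - Suc r} \<union> \<gamma>))"
  proof (rule positive_of_intervals[OF assms(1), of _ "Suc r" _ _ "k - Suc r" "N - (k - Suc r)"])
    fix \<delta> assume "\<delta> \<subseteq> {Suc (k - Suc r)..<N}" "Suc (card \<delta>) = Suc r"
    moreover have "{..k - Suc r} = {..<k - r}" using Suc.prems(1) by auto
    ultimately show "0 < p ({..k - Suc r} \<union> \<delta>)"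
      using Suc.IH[of \<delta>] Suc.prems(1) by (simp add: Suc_diff_Suc)
  next
    fix t assume t: "k - Suc r \<le> t" "t + Suc r \<le> N"
    let ?\<alpha> = "{..<k - Suc r} \<union> {t..<t + Suc r}"
    have "?\<alpha> \<in> test_index_sets k N"
      unfolding test_index_sets_def using Suc.prems(1) t
      by (intro CollectI exI[of _ "Suc r"] exI[of _ t]) auto
    moreover have "0 \<in> ?\<alpha>" using Suc.prems(1) by auto
    then have "?\<alpha> \<notin> weak_index_sets k N" using zero_notin_weak_index_set[OF assms(2)] by blast
    ultimately show "0 \<le> p ?\<alpha> \<and> (True \<longrightarrow> 0 < p ?\<alpha>)"
      using test by (metis less_imp_le)
  qed (use Suc.prems assms(3) in auto)
  then show ?case by simp
qed

text \<open>
  The stage of empty prefix, the only one at which weak sets occur. With \<open>strict\<close> true this is the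
  criterion for strict positivity, with \<open>strict\<close> false the one for nonnegativity.
\<close>

lemma positive_of_test_sets:
  fixes p :: "nat set \<Rightarrow> real"
  assumes "three_term_plucker k N p" "k \<ge> 1" "k \<le> N"
    and test: "\<And>\<alpha>. \<alpha> \<in> test_index_sets k N \<Longrightarrow> \<alpha> \<notin> weak_index_sets k N \<Longrightarrow> 0 < p \<alpha>"
    and weak: "\<And>\<alpha>. \<alpha> \<in> weak_index_sets k N \<Longrightarrow> 0 \<le> p \<alpha> \<and> (strict \<longrightarrow> 0 < p \<alpha>)"
    and "\<alpha> \<subseteq> {..<N}" "card \<alpha> = k"
  shows "0 \<le> p \<alpha> \<and> (strict \<longrightarrow> 0 < p \<alpha>)"
proof -
  have "0 \<le> p ({..<0} \<union> \<alpha>) \<and> (strict \<longrightarrow> 0 < p ({..<0} \<union> \<alpha>))"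
  proof (rule positive_of_intervals[OF assms(1), of _ k _ _ 0 N])
    fix \<delta> assume \<delta>: "\<delta> \<subseteq> {Suc 0..<N}" "Suc (card \<delta>) = k"
    then have "k - card \<delta> = Suc 0" by simp
    with \<delta> show "0 < p ({..0} \<union> \<delta>)"
      using prefix_positive[OF assms(1-3) test, of "card \<delta>" \<delta>] by (simp add: lessThan_Suc)
  next
    fix t assume t: "0 \<le> t" "t + k \<le> N"
    have "{t..<t + k} \<in> test_index_sets k N"
      unfolding test_index_sets_def using assms(2) t
      by (intro CollectI exI[of _ k] exI[of _ t]) auto
    then show "0 \<le> p ({..<0} \<union> {t..<t + k}) \<and> (strict \<longrightarrow> 0 < p ({..<0} \<union> {t..<t + k}))"
      using test[of "{t..<t + k}"] weak[of "{t..<t + k}"] by force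
  qed (use assms in auto)
  then show ?thesis by simp
qed

section \<open>Rows and columns together\<close>

lemma signed_minors_nonneg:
  fixes X :: "real mat" and s :: real
  assumes X: "X \<in> carrier_mat n m" and k: "k \<ge> 1" "k \<le> n" "k \<le> m"
    and test: "\<And>\<alpha> \<beta>. \<alpha> \<in> test_index_sets k n \<Longrightarrow> \<beta> \<in> test_index_sets k m \<Longrightarrow>
      if \<alpha> \<in> weak_index_sets k n \<and> \<beta> \<in> weak_index_sets k m
      then 0 \<le> s * det (submatrix X \<alpha> \<beta>) else 0 < s * det (submatrix X \<alpha> \<beta>)"
    and \<alpha>: "\<alpha> \<subseteq> {..<n}" "card \<alpha> = k" and \<beta>: "\<beta> \<subseteq> {..<m}" "card \<beta> = k"
  shows "0 \<le> s * det (submatrix X \<alpha> \<beta>)"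
proof -
  \<comment> \<open>a column test set that is not weak gives strict positivity, as the columns' turn will require\<close>
  have rows: "0 \<le> s * det (submatrix X \<alpha> \<beta>) \<and>
      (\<beta> \<notin> weak_index_sets k m \<longrightarrow> 0 < s * det (submatrix X \<alpha> \<beta>))"
    if "\<beta> \<in> test_index_sets k m" for \<beta>
  proof -
    note \<beta> = test_index_set_subset_card[OF k(3) that]
    define p where
      "p \<alpha> = s * row_det k (\<lambda>i j. X $$ (i, sorted_list_of_set \<beta> ! j)) (sorted_list_of_set \<alpha>)" for \<alpha>
    have plucker: "three_term_plucker k n p"
      unfolding p_def by (intro three_term_plucker_scale three_term_plucker_row_det)
    have p: "p \<alpha> = s * det (submatrix X \<alpha> \<beta>)" if "\<alpha> \<subseteq> {..<n}" "card \<alpha> = k" for \<alpha>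
      using det_submatrix_eq_row_det[of \<alpha> X k \<beta>] that \<beta> X by (simp add: p_def)
    have p_test: "p \<alpha> = s * det (submatrix X \<alpha> \<beta>)" if "\<alpha> \<in> test_index_sets k n" for \<alpha>
      using p test_index_set_subset_card[OF k(2) that] by blast
    have "0 \<le> p \<alpha> \<and> (\<beta> \<notin> weak_index_sets k m \<longrightarrow> 0 < p \<alpha>)"
    proof (rule positive_of_test_sets[OF plucker k(1,2)])
      fix \<alpha> assume "\<alpha> \<in> test_index_sets k n" "\<alpha> \<notin> weak_index_sets k n"
      then show "0 < p \<alpha>" using test[of \<alpha> \<beta>] p_test[of \<alpha>] that by simp
    next
      fix \<alpha> assume "\<alpha> \<in> weak_index_sets k n"
      moreover from this have "\<alpha> \<in> test_index_sets k n"
        using weak_index_sets_subset[OF k(1)] by blast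
      ultimately show "0 \<le> p \<alpha> \<and> (\<beta> \<notin> weak_index_sets k m \<longrightarrow> 0 < p \<alpha>)"
        using test[of \<alpha> \<beta>] p_test[of \<alpha>] that by (auto split: if_splits)
    qed (use \<alpha> in auto)
    then show ?thesis using p[OF \<alpha>] by simp
  qed
  define p where
    "p \<beta> = s * row_det k (\<lambda>j i. X $$ (sorted_list_of_set \<alpha> ! i, j)) (sorted_list_of_set \<beta>)" for \<beta>
  have plucker: "three_term_plucker k m p"
    unfolding p_def by (intro three_term_plucker_scale three_term_plucker_row_det)
  have p: "p \<beta> = s * det (submatrix X \<alpha> \<beta>)" if "\<beta> \<subseteq> {..<m}" "card \<beta> = k" for \<beta>
    using det_submatrix_eq_col_det[of \<alpha> X k \<beta>] that \<alpha> X by (simp add: p_def)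
  have p_test: "p \<beta> = s * det (submatrix X \<alpha> \<beta>)" if "\<beta> \<in> test_index_sets k m" for \<beta>
    using p test_index_set_subset_card[OF k(3) that] by blast
  have "0 \<le> p \<beta> \<and> (False \<longrightarrow> 0 < p \<beta>)"
  proof (rule positive_of_test_sets[OF plucker k(1,3)])
    fix \<beta> assume "\<beta> \<in> test_index_sets k m" "\<beta> \<notin> weak_index_sets k m"
    then show "0 < p \<beta>" using rows[of \<beta>] p_test[of \<beta>] by simp
  next
    fix \<beta> assume "\<beta> \<in> weak_index_sets k m"
    then have "\<beta> \<in> test_index_sets k m"
      using weak_index_sets_subset[OF k(1)] by blast
    then show "0 \<le> p \<beta> \<and> (False \<longrightarrow> 0 < p \<beta>)"
      using rows[of \<beta>] p_test[of \<beta>] by simp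
  qed (use \<beta> in auto)
  then show ?thesis using p[OF \<beta>] by simp
qed

theorem corollary3:
  fixes X :: "real mat" and n m k :: nat
  assumes "X \<in> carrier_mat n m"
    and "n > m"
    and "k \<ge> 1"
    and "2 * k \<le> m"
    and "(\<forall>\<alpha>\<in>test_index_sets k n. \<forall>\<beta>\<in>test_index_sets k m.
            if \<alpha> \<in> weak_index_sets k n \<and> \<beta> \<in> weak_index_sets k m
            then det (submatrix X \<alpha> \<beta>) \<ge> 0 else det (submatrix X \<alpha> \<beta>) > 0) \<or>
         (\<forall>\<alpha>\<in>test_index_sets k n. \<forall>\<beta>\<in>test_index_sets k m.
            if \<alpha> \<in> weak_index_sets k n \<and> \<beta> \<in> weak_index_sets k m
            then det (submatrix X \<alpha> \<beta>) \<le> 0 else det (submatrix X \<alpha> \<beta>) < 0)"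
  shows "sign_consistent k X"
proof -
  have k: "k \<le> n" "k \<le> m" using assms by auto
  note minors = signed_minors_nonneg[OF assms(1,3) k]
  from assms(5) show ?thesis
  proof
    assume "\<forall>\<alpha>\<in>test_index_sets k n. \<forall>\<beta>\<in>test_index_sets k m.
      if \<alpha> \<in> weak_index_sets k n \<and> \<beta> \<in> weak_index_sets k m
      then det (submatrix X \<alpha> \<beta>) \<ge> 0 else det (submatrix X \<alpha> \<beta>) > 0"
    then have "0 \<le> det (submatrix X \<alpha> \<beta>)"
      if "\<alpha> \<subseteq> {..<n}" "card \<alpha> = k" "\<beta> \<subseteq> {..<m}" "card \<beta> = k" for \<alpha> \<beta>
      using minors[of 1 \<alpha> \<beta>] that by simp
    then show ?thesis using assms(1) unfolding sign_consistent_def by auto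
  next
    assume "\<forall>\<alpha>\<in>test_index_sets k n. \<forall>\<beta>\<in>test_index_sets k m.
      if \<alpha> \<in> weak_index_sets k n \<and> \<beta> \<in> weak_index_sets k m
      then det (submatrix X \<alpha> \<beta>) \<le> 0 else det (submatrix X \<alpha> \<beta>) < 0"
    then have "det (submatrix X \<alpha> \<beta>) \<le> 0"
      if "\<alpha> \<subseteq> {..<n}" "card \<alpha> = k" "\<beta> \<subseteq> {..<m}" "card \<beta> = k" for \<alpha> \<beta>
      using minors[of "- 1" \<alpha> \<beta>] that by simp
    then show ?thesis using assms(1) unfolding sign_consistent_def by auto
  qed
qed

end
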